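(* Let $\mathcal{H}$ and $\mathcal{A}$ be finite nonempty sets, $P$ a probability distribution on $\mathcal{H}$, $Z$ a fixed consequence geometry with utilities $U(a\mid H,Z)\in\mathbb{R}$, and $\pi^*(\cdot,Z)$ the full-information optimal policy. Let $c:\mathcal{H}\to\mathbb{R}$ be a scalar confidence map and let $g_c(H)=c(H)$ be confidence-only compression. Suppose that for some $c_0\in\mathbb{R}$ there are $H_1,H_2\in\mathcal{H}$ with $P(H_1)>0$, $P(H_2)>0$, $c(H_1)=c(H_2)=c_0$, and $\pi^*(H_1,Z)\neq\pi^*(H_2,Z)$. For each value $v$ of $c$ let $C_v=\{H\in\mathcal{H}:c(H)=v\}$ and $$\Delta(C_v;Z)=\sum_{H\in C_v}P(H)\max_{a\in\mathcal{A}}U(a\mid H,Z)-\max_{a\in\mathcal{A}}\sum_{H\in C_v}P(H)\,U(a\mid H,Z).$$ Then: (1) confidence-only compression incurs regret $\Delta(C_{c_0};Z)$ on the cell $C_{c_0}$, i.e. $\sum_{H\in C_{c_0}}P(H)\,R_{g_c}(H,Z)=\Delta(C_{c_0};Z)$; (2) if $\Delta(C_{c_0};Z)>0$, then $g_c$ is not exactly action-sufficient for $Z$; (3) for $\varepsilon\ge 0$, if the total regret $\sum_{v\in c(\mathcal{H})}\Delta(C_v;Z)$ exceeds $\varepsilon$, then $g_c$ is not $\varepsilon$-action-sufficient for $Z$; (4) the existence of states in $C_{c_0}$ with different full-information optimal actions (as assumed) already implies that $g_c$ is not exactly action-sufficient for $Z$.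
   Context: For each $H\in\mathcal{H}$, $\pi^*(H,Z)$ is the element of $\arg\max_{a\in\mathcal{A}}U(a\mid H,Z)$ selected by a fixed tie-breaking rule. A compression is a map $g:\mathcal{H}\to\mathcal{S}$. For $s$ with $P(g(H)=s)>0$, the compressed utility is $U_g(a\mid s,Z)=\mathbb{E}[U(a\mid H,Z)\mid g(H)=s]$ and the expected-utility compressed policy $\pi_g(s,Z)$ is an element of $\arg\max_{a\in\mathcal{A}}U_g(a\mid s,Z)$ (selected by a fixed tie-breaking rule); on codes $s$ of probability zero $\pi_g(s,Z)$ may be any action. The regret of $g$ at $H$ is $R_g(H,Z)=U(\pi^*(H,Z)\mid H,Z)-U(\pi_g(g(H),Z)\mid H,Z)$, and $g$ is $\varepsilon$-action-sufficient for $Z$ if $\sum_{H}P(H)R_g(H,Z)\le\varepsilon$. Exact action sufficiency is evaluated pointwise with compressed policies defined directly on codes: $g$ is exactly action-sufficient for $Z$ if there is a function $f:\mathcal{S}\to\mathcal{A}$ with $f(g(H))=\pi^*(H,Z)$ for all $H\in\mathcal{H}$. *)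

theory Defs
  imports "HOL-Probability.Probability_Mass_Function"
begin

definition argmax :: "'a set \<Rightarrow> ('a \<Rightarrow> real) \<Rightarrow> 'a set" where
  "argmax A u = {a. is_arg_max u (\<lambda>a. a \<in> A) a}"

text \<open>
  Tie-breaking is arbitrary: a policy is any selection from the argmax sets, possibly depending
  on the state or code. The consequence geometry \<open>Z\<close> is an argument of otherwise unconstrained
  type; policies are only constrained at the given \<open>Z\<close>.
\<close>

definition full_information_policy ::
  "'h set \<Rightarrow> 'a set \<Rightarrow> ('a \<Rightarrow> 'h \<Rightarrow> 'z \<Rightarrow> real) \<Rightarrow> 'z \<Rightarrow> ('h \<Rightarrow> 'z \<Rightarrow> 'a) \<Rightarrow> bool" where
  "full_information_policy \<H> A U Z \<pi> \<longleftrightarrow> (\<forall>H\<in>\<H>. \<pi> H Z \<in> argmax A (\<lambda>a. U a H Z))"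

text \<open>Only meaningful for codes of positive probability; elsewhere \<open>cond_pmf\<close> is unspecified.\<close>

definition compressed_utility ::
  "'h pmf \<Rightarrow> ('a \<Rightarrow> 'h \<Rightarrow> 'z \<Rightarrow> real) \<Rightarrow> ('h \<Rightarrow> 's) \<Rightarrow> 'a \<Rightarrow> 's \<Rightarrow> 'z \<Rightarrow> real" where
  "compressed_utility P U g a s Z =
     measure_pmf.expectation (cond_pmf P {H. g H = s}) (\<lambda>H. U a H Z)"

definition compressed_policy ::
  "'a set \<Rightarrow> 'h pmf \<Rightarrow> ('a \<Rightarrow> 'h \<Rightarrow> 'z \<Rightarrow> real) \<Rightarrow> ('h \<Rightarrow> 's) \<Rightarrow> 'z \<Rightarrow> ('s \<Rightarrow> 'z \<Rightarrow> 'a) \<Rightarrow> bool" where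
  "compressed_policy A P U g Z \<pi> \<longleftrightarrow>
     (\<forall>s. \<pi> s Z \<in> A \<and>
        (measure_pmf.prob P {H. g H = s} > 0 \<longrightarrow>
          \<pi> s Z \<in> argmax A (\<lambda>a. compressed_utility P U g a s Z)))"

definition regret ::
  "('a \<Rightarrow> 'h \<Rightarrow> 'z \<Rightarrow> real) \<Rightarrow> ('h \<Rightarrow> 'z \<Rightarrow> 'a) \<Rightarrow> ('s \<Rightarrow> 'z \<Rightarrow> 'a) \<Rightarrow> ('h \<Rightarrow> 's) \<Rightarrow> 'h \<Rightarrow> 'z \<Rightarrow> real" where
  "regret U \<pi>' \<pi>g g H Z = U (\<pi>' H Z) H Z - U (\<pi>g (g H) Z) H Z"

definition eps_action_sufficient ::
  "'h set \<Rightarrow> 'h pmf \<Rightarrow> ('a \<Rightarrow> 'h \<Rightarrow> 'z \<Rightarrow> real) \<Rightarrow> ('h \<Rightarrow> 'z \<Rightarrow> 'a) \<Rightarrow> ('s \<Rightarrow> 'z \<Rightarrow> 'a) \<Rightarrow>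
    real \<Rightarrow> ('h \<Rightarrow> 's) \<Rightarrow> 'z \<Rightarrow> bool" where
  "eps_action_sufficient \<H> P U \<pi>' \<pi>g \<epsilon> g Z \<longleftrightarrow>
     (\<Sum>H\<in>\<H>. pmf P H * regret U \<pi>' \<pi>g g H Z) \<le> \<epsilon>"

definition exactly_action_sufficient ::
  "'h set \<Rightarrow> 'a set \<Rightarrow> ('h \<Rightarrow> 'z \<Rightarrow> 'a) \<Rightarrow> ('h \<Rightarrow> 's) \<Rightarrow> 'z \<Rightarrow> bool" where
  "exactly_action_sufficient \<H> A \<pi>' g Z \<longleftrightarrow>
     (\<exists>f. (\<forall>s. f s \<in> A) \<and> (\<forall>H\<in>\<H>. f (g H) = \<pi>' H Z))"

definition cell :: "'h set \<Rightarrow> ('h \<Rightarrow> real) \<Rightarrow> real \<Rightarrow> 'h set" where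
  "cell \<H> c v = {H \<in> \<H>. c H = v}"

definition cell_regret ::
  "'a set \<Rightarrow> 'h pmf \<Rightarrow> ('a \<Rightarrow> 'h \<Rightarrow> 'z \<Rightarrow> real) \<Rightarrow> 'h set \<Rightarrow> 'z \<Rightarrow> real" where
  "cell_regret A P U C Z =
     (\<Sum>H\<in>C. pmf P H * Max ((\<lambda>a. U a H Z) ` A)) - Max ((\<lambda>a. \<Sum>H\<in>C. pmf P H * U a H Z) ` A)"

end

theory Submission
  imports Defs
begin

text \<open>
  On a code \<open>v\<close> of positive probability the compressed utility is, up to the positive factor
  \<open>P (c H = v)\<close>, the cell-wise sum of \<open>P H * U a H Z\<close>; hence the compressed policy maximises this
  sum and its regret on the cell is the cell regret. On a null code both sides vanish. Summing over
  all codes, which partition \<open>\<H>\<close>, gives the total regret.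
\<close>

lemma mem_argmax_iff: "a \<in> argmax A u \<longleftrightarrow> a \<in> A \<and> (\<forall>b\<in>A. u b \<le> u a)"
  by (auto simp: argmax_def is_arg_max_linorder)

lemma Max_image_argmax:
  assumes "finite A" "a \<in> argmax A u"
  shows "Max (u ` A) = u a"
  using assms by (intro Max_eqI) (auto simp: mem_argmax_iff)

text \<open>The event on the left ranges over the whole type, the cell only over
  \<open>\<H>\<close>. They differ by a null set because the support of \<open>P\<close> lies in
  \<open>\<H>\<close>.\<close>

lemma prob_eq_sum_cell:
  assumes "finite \<H>" "set_pmf P \<subseteq> \<H>"
  shows "measure_pmf.prob P {H. c H = v} = (\<Sum>H\<in>cell \<H> c v. pmf P H)"
proof -
  have "measure_pmf.prob P {H. c H = v} = measure_pmf.prob P (cell \<H> c v)"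
    using assms(2) by (intro measure_eq_AE) (auto simp: cell_def AE_measure_pmf_iff)
  also have "\<dots> = (\<Sum>H\<in>cell \<H> c v. pmf P H)"
    using assms(1) by (intro measure_measure_pmf_finite) (simp add: cell_def)
  finally show ?thesis .
qed

text \<open>Clearing the denominator of the conditional expectation lets argmax statements about
  codes be read as statements about plain finite sums.\<close>

lemma prob_mult_compressed_utility:
  assumes "finite \<H>" "set_pmf P \<subseteq> \<H>" and pos: "measure_pmf.prob P {H. c H = v} > 0"
  shows "measure_pmf.prob P {H. c H = v} * compressed_utility P U c a v Z
           = (\<Sum>H\<in>cell \<H> c v. pmf P H * U a H Z)"
proof -
  let ?p = "measure_pmf.prob P {H. c H = v}"
  \<comment> \<open>This is the condition under which \<open>cond_pmf\<close> is specified.\<close>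
  have ne: "set_pmf P \<inter> {H. c H = v} \<noteq> {}"
    using pos by (metis measure_pmf_zero_iff less_irrefl)
  have "compressed_utility P U c a v Z
          = (\<Sum>H\<in>cell \<H> c v. U a H Z * pmf (cond_pmf P {H. c H = v}) H)"
    \<comment> \<open>The cell is finite and contains the support of the conditional distribution,
      so the integral is a finite sum over it.\<close>
    unfolding compressed_utility_def using assms(1,2) ne
    by (intro integral_measure_pmf_real) (auto simp: cell_def set_cond_pmf)
  also have "\<dots> = (\<Sum>H\<in>cell \<H> c v. pmf P H * U a H Z / ?p)"
    by (intro sum.cong) (auto simp: cell_def pmf_cond[OF ne])
  finally show ?thesis
    using pos by (simp flip: sum_divide_distrib)
qed

lemma sum_regret_cell:
  assumes "finite \<H>" "finite A" "A \<noteq> {}" "set_pmf P \<subseteq> \<H>"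
    and "full_information_policy \<H> A U Z \<pi>_star"
    and "compressed_policy A P U c Z \<pi>_c"
  shows "(\<Sum>H\<in>cell \<H> c v. pmf P H * regret U \<pi>_star \<pi>_c c H Z)
           = cell_regret A P U (cell \<H> c v) Z"
proof -
  let ?C = "cell \<H> c v"
  let ?p = "measure_pmf.prob P {H. c H = v}"
  let ?W = "\<lambda>a. \<Sum>H\<in>?C. pmf P H * U a H Z"
  have W: "Max (?W ` A) = ?W (\<pi>_c v Z)"
  proof (cases "?p > 0")
    case True
    then have "\<pi>_c v Z \<in> argmax A (\<lambda>a. compressed_utility P U c a v Z)"
      using assms(6) by (simp add: compressed_policy_def)
    \<comment> \<open>Scaling by the positive constant \<open>?p\<close> leaves the maximisers
      unchanged.\<close>
    then have "\<pi>_c v Z \<in> argmax A (\<lambda>a. ?p * compressed_utility P U c a v Z)"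
      using True by (simp add: mem_argmax_iff)
    then have "\<pi>_c v Z \<in> argmax A ?W"
      using assms(1,4) True by (simp add: prob_mult_compressed_utility)
    then show ?thesis
      using assms(2) by (rule Max_image_argmax[rotated])
  next
    case False
    then have "(\<Sum>H\<in>?C. pmf P H) = 0"
      using prob_eq_sum_cell[OF assms(1,4), of c v] measure_nonneg[of P "{H. c H = v}"] by simp
    then have "\<forall>H\<in>?C. pmf P H = 0"
      using assms(1) by (subst (asm) sum_nonneg_eq_0_iff) (auto simp: cell_def)
    then have "?W a = 0" for a
      by simp
    \<comment> \<open>\<open>?W\<close> maps the nonempty set \<open>A\<close> onto
      \<open>{0}\<close>, so any action chosen on a null code attains the maximum.\<close>
    then show ?thesis
      using assms(3) by (simp add: image_constant_conv)
  qed
  have "Max ((\<lambda>a. U a H Z) ` A) = U (\<pi>_star H Z) H Z" if "H \<in> ?C" for H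
    using that assms(2,5)
    by (intro Max_image_argmax) (auto simp: full_information_policy_def cell_def)
  then have "cell_regret A P U ?C Z
      = (\<Sum>H\<in>?C. pmf P H * U (\<pi>_star H Z) H Z) - ?W (\<pi>_c v Z)"
    by (simp add: cell_regret_def W)
  also have "\<dots> = (\<Sum>H\<in>?C. pmf P H * regret U \<pi>_star \<pi>_c c H Z)"
    unfolding sum_subtractf[symmetric]
    by (intro sum.cong) (auto simp: regret_def cell_def right_diff_distrib)
  finally show ?thesis ..
qed

lemma sum_regret:
  assumes "finite \<H>" "finite A" "A \<noteq> {}" "set_pmf P \<subseteq> \<H>"
    and "full_information_policy \<H> A U Z \<pi>_star"
    and "compressed_policy A P U c Z \<pi>_c"
  shows "(\<Sum>H\<in>\<H>. pmf P H * regret U \<pi>_star \<pi>_c c H Z)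
           = (\<Sum>v\<in>c ` \<H>. cell_regret A P U (cell \<H> c v) Z)"
  \<comment> \<open>Each cell regret becomes a sum over a fibre of \<open>c\<close>; what remains is
    the grouping of a finite sum by fibres.\<close>
  unfolding sum_regret_cell[OF assms, symmetric]
  unfolding cell_def
  using assms(1) by (rule sum.image_gen)

text \<open>A decoder \<open>f\<close> sees only the common code, so it would have to return both
  optimal actions at once.\<close>

lemma not_exactly_action_sufficient:
  assumes "H\<^sub>1 \<in> \<H>" "H\<^sub>2 \<in> \<H>" "g H\<^sub>1 = g H\<^sub>2" "\<pi> H\<^sub>1 Z \<noteq> \<pi> H\<^sub>2 Z"
  shows "\<not> exactly_action_sufficient \<H> A \<pi> g Z"
  using assms unfolding exactly_action_sufficient_def by metis

theorem proposition2:
  fixes \<H> :: "'h set" and A :: "'a set" and P :: "'h pmf"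
    and U :: "'a \<Rightarrow> 'h \<Rightarrow> 'z \<Rightarrow> real" and Z :: 'z
    and \<pi>_star :: "'h \<Rightarrow> 'z \<Rightarrow> 'a" and \<pi>_c :: "real \<Rightarrow> 'z \<Rightarrow> 'a"
    and c :: "'h \<Rightarrow> real" and c\<^sub>0 :: real and H\<^sub>1 H\<^sub>2 :: 'h
  assumes "finite \<H>" and "\<H> \<noteq> {}" and "finite A" and "A \<noteq> {}"
    and "set_pmf P \<subseteq> \<H>"
    and "full_information_policy \<H> A U Z \<pi>_star"
    and "compressed_policy A P U c Z \<pi>_c"
    and "H\<^sub>1 \<in> \<H>" and "H\<^sub>2 \<in> \<H>"
    and "pmf P H\<^sub>1 > 0" and "pmf P H\<^sub>2 > 0"
    and "c H\<^sub>1 = c\<^sub>0" and "c H\<^sub>2 = c\<^sub>0"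
    and "\<pi>_star H\<^sub>1 Z \<noteq> \<pi>_star H\<^sub>2 Z"
  shows "(\<Sum>H\<in>cell \<H> c c\<^sub>0. pmf P H * regret U \<pi>_star \<pi>_c c H Z)
           = cell_regret A P U (cell \<H> c c\<^sub>0) Z
    \<and> (cell_regret A P U (cell \<H> c c\<^sub>0) Z > 0
           \<longrightarrow> \<not> exactly_action_sufficient \<H> A \<pi>_star c Z)
    \<and> (\<forall>\<epsilon>\<ge>0. (\<Sum>v\<in>c ` \<H>. cell_regret A P U (cell \<H> c v) Z) > \<epsilon>
           \<longrightarrow> \<not> eps_action_sufficient \<H> P U \<pi>_star \<pi>_c \<epsilon> c Z)
    \<and> \<not> exactly_action_sufficient \<H> A \<pi>_star c Z"
proof -
  have not_exact: "\<not> exactly_action_sufficient \<H> A \<pi>_star c Z"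
    using assms by (intro not_exactly_action_sufficient[of H\<^sub>1 _ H\<^sub>2]) auto
  show ?thesis
    \<comment> \<open>The \<epsilon> clause compares the same number with \<epsilon> twice, once
      \<open>sum_regret\<close> has rewritten the expected regret as the sum over cells.\<close>
    using not_exact sum_regret_cell[OF assms(1,3,4,5,6,7)]
    by (simp add: eps_action_sufficient_def sum_regret[OF assms(1,3,4,5,6,7)])
qed

end
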